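(* Let $M=2^{2\lambda}$ with $\lambda$ any positive integer. Then the number of singular fade states of the square $M$-QAM signal set is always less than the number of singular fade states of the $M$-PSK signal set.
   Context: A fade state is a nonzero complex number $z=\gamma e^{j\theta}$ ($\gamma>0$, $-\pi\le\theta<\pi$, $j=\sqrt{-1}$). For a finite signal set $\mathcal{S}\subset\mathbb{C}$ used at both end nodes, a fade state $z$ is a singular fade state if $\{x+z y : x,y\in\mathcal{S}\}$ has fewer than $|\mathcal{S}|^2$ elements. The square $M$-QAM signal set is $\{a+jb : a,b\in P\}$ with $P=\{-(\sqrt M-1)+2n : n=0,1,\dots,\sqrt M-1\}$. The $M$-PSK signal set is $\{e^{2\pi jk/M} : k=0,1,\dots,M-1\}$. It is known from earlier work that the number of singular fade states of $M$-PSK is $M\left(\frac{M^2}{4}-\frac M2+1\right)$, which is in $\mathcal{O}(M^3)$. The comparison is supported by the upper bound $4(n^2-n+1)$, with $n=\frac{(2\sqrt M-1)^2-1}{4}$, on the number of singular fade states of square $M$-QAM, which is in $\mathcal{O}(M^2)$.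
   Formalization: The claim is proved for λ ≥ 2 instead of every positive integer λ; for λ = 1 (M = 4) it is false, since 4-PSK is a scaled rotation of 4-QAM and both have the same 12 singular fade states. *)

theory Defs
  imports "HOL-Analysis.Analysis"
begin

definition fade_state :: "complex \<Rightarrow> bool" where
  "fade_state z \<longleftrightarrow> z \<noteq> 0"

definition effective_constellation :: "complex set \<Rightarrow> complex \<Rightarrow> complex set" where
  "effective_constellation S z = {x + z * y | x y. x \<in> S \<and> y \<in> S}"

definition singular_fade_states :: "complex set \<Rightarrow> complex set" where
  "singular_fade_states S =
     {z. fade_state z \<and> card (effective_constellation S z) < (card S)\<^sup>2}"

definition pam_points :: "nat \<Rightarrow> real set" where
  "pam_points M = {- (sqrt (real M) - 1) + 2 * real n | n :: nat. real n \<le> sqrt (real M) - 1}"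

definition square_qam :: "nat \<Rightarrow> complex set" where
  "square_qam M =
     {complex_of_real a + \<i> * complex_of_real b | a b. a \<in> pam_points M \<and> b \<in> pam_points M}"

definition psk :: "nat \<Rightarrow> complex set" where
  "psk M = {exp (2 * complex_of_real pi * \<i> * of_nat k / of_nat M) | k :: nat. k < M}"

text \<open>The set of singular fade states is finite, so its \<^const>\<open>card\<close> is the true number of
  elements and not the default value \<open>0\<close>.\<close>

lemma finite_singular_fade_states:
  assumes "finite S"
  shows "finite (singular_fade_states S)"
proof (rule finite_subset)
  let ?f = "\<lambda>(x, y, x', y'). (x - x') / (y' - y) :: complex"
  show "finite (?f ` (S \<times> S \<times> S \<times> S))"
    using assms by blast
  show "singular_fade_states S \<subseteq> ?f ` (S \<times> S \<times> S \<times> S)"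
  proof
    fix z assume z: "z \<in> singular_fade_states S"
    let ?g = "\<lambda>(x, y). x + z * y"
    have im: "effective_constellation S z = ?g ` (S \<times> S)"
      by (auto simp: effective_constellation_def image_iff)
    have "\<not> inj_on ?g (S \<times> S)"
      using z card_image[of ?g "S \<times> S"]
      by (auto simp: singular_fade_states_def im card_cartesian_product power2_eq_square)
    then obtain x y x' y' where
      mem: "x \<in> S" "y \<in> S" "x' \<in> S" "y' \<in> S" and
      eq: "x + z * y = x' + z * y'" and ne: "(x, y) \<noteq> (x', y')"
      by (auto simp: inj_on_def)
    have "y \<noteq> y'"
      using eq ne by auto
    moreover have "z * (y' - y) = x - x'"
      using eq by (simp add: algebra_simps)
    ultimately have "z = ?f (x, y, x', y')"
      by (simp add: field_simps)
    then show "z \<in> ?f ` (S \<times> S \<times> S \<times> S)"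
      using mem by blast
  qed
qed

lemma finite_pam_points: "finite (pam_points M)"
proof (rule finite_subset)
  show "pam_points M \<subseteq> (\<lambda>n. - (sqrt (real M) - 1) + 2 * real n) ` {..nat \<lfloor>sqrt (real M) - 1\<rfloor>}"
  proof
    fix a assume "a \<in> pam_points M"
    then obtain n :: nat where "a = - (sqrt (real M) - 1) + 2 * real n" "real n \<le> sqrt (real M) - 1"
      by (auto simp: pam_points_def)
    then show "a \<in> (\<lambda>n. - (sqrt (real M) - 1) + 2 * real n) ` {..nat \<lfloor>sqrt (real M) - 1\<rfloor>}"
      using le_nat_floor[of n "sqrt (real M) - 1"] by blast
  qed
qed simp

lemma finite_square_qam: "finite (square_qam M)"
proof -
  have "square_qam M =
      (\<lambda>(a, b). complex_of_real a + \<i> * complex_of_real b) ` (pam_points M \<times> pam_points M)"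
    by (auto simp: square_qam_def image_iff)
  then show ?thesis
    by (simp add: finite_pam_points)
qed

lemma finite_psk: "finite (psk M)"
  by (simp add: psk_def)

lemma singular_fade_states_scale:
  assumes "c \<noteq> 0"
  shows "singular_fade_states ((*) c ` S) = singular_fade_states S"
proof -
  have inj: "inj_on ((*) c) A" for A
    using assms by (auto simp: inj_on_def)
  have "effective_constellation ((*) c ` S) z = (*) c ` effective_constellation S z" for z
  proof -
    have "effective_constellation T z = (\<lambda>(x, y). x + z * y) ` (T \<times> T)" for T
      by (auto simp: effective_constellation_def image_iff)
    moreover have "(*) c ` S \<times> (*) c ` S = (\<lambda>(x, y). (c * x, c * y)) ` (S \<times> S)"
      by auto
    ultimately show ?thesis
      by (auto simp: image_image case_prod_unfold algebra_simps)
  qed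
  then show ?thesis
    by (simp add: singular_fade_states_def card_image[OF inj])
qed

text \<open>At \<open>M = 4\<close> the two signal sets are similar, hence have the same singular fade states
  (there are twelve). The strict comparison of the two counts therefore fails for \<open>M = 4\<close>,
  and can only be claimed from \<open>M = 16\<close> on.\<close>

lemma psk_4: "psk 4 = {1, \<i>, -1, -\<i>}"
proof -
  have "psk 4 = (\<lambda>k. exp (2 * complex_of_real pi * \<i> * of_nat k / of_nat 4)) ` {..<4}"
    by (auto simp: psk_def)
  also have "{..<4::nat} = {0, 1, 2, 3}"
    by auto
  also have "(\<lambda>k. exp (2 * complex_of_real pi * \<i> * of_nat k / of_nat 4)) ` {0, 1, 2, 3} =
      (\<lambda>k. \<i> ^ k) ` {0, 1, 2, 3 :: nat}"
  proof (rule image_cong[OF refl])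
    fix k :: nat
    have "exp (2 * complex_of_real pi * \<i> * of_nat k / of_nat 4) =
        exp (of_nat k * (\<i> * complex_of_real (pi / 2)))"
      by (simp add: field_simps)
    also have "\<dots> = exp (\<i> * complex_of_real (pi / 2)) ^ k"
      by (rule exp_of_nat_mult)
    also have "exp (\<i> * complex_of_real (pi / 2)) = \<i>"
      by (metis cis_conv_exp cis_pi_half)
    finally show "exp (2 * complex_of_real pi * \<i> * of_nat k / of_nat 4) = \<i> ^ k" .
  qed
  finally show ?thesis
    by (simp add: eval_nat_numeral)
qed

lemma square_qam_4: "square_qam 4 = {1 + \<i>, 1 - \<i>, -1 + \<i>, -1 - \<i>}"
proof -
  have "sqrt 4 = 2"
    using real_sqrt_abs[of 2] by simp
  then have "pam_points 4 = (\<lambda>n. - 1 + 2 * real n) ` {..1}"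
    by (auto simp: pam_points_def)
  also have "{..1::nat} = {0, 1}"
    by auto
  finally have "pam_points 4 = {-1, 1}"
    by simp
  moreover have "square_qam 4 =
      (\<lambda>(a, b). complex_of_real a + \<i> * complex_of_real b) ` (pam_points 4 \<times> pam_points 4)"
    by (auto simp: square_qam_def image_iff)
  ultimately show ?thesis
    by (auto simp: insert_Times_insert)
qed

lemma singular_fade_states_4:
  "singular_fade_states (square_qam 4) = singular_fade_states (psk 4)"
proof -
  have "psk 4 = (*) ((1 + \<i>) / 2) ` square_qam 4"
    by (auto simp: psk_4 square_qam_4 field_simps)
  moreover have "(1 + \<i>) / 2 \<noteq> 0"
    by (simp add: complex_eq_iff)
  ultimately show ?thesis
    by (metis singular_fade_states_scale)
qed

end

theory Submission
  imports Defs "HOL-Computational_Algebra.Polynomial_Factorial"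
begin

text \<open>Up to a unit of the Gaussian integers, every nonzero difference of points of square
  \<open>M\<close>-QAM with \<open>M = s\<^sup>2\<close> is twice one of the \<open>s (s - 1)\<close> Gaussian integers \<open>a + i b\<close> with
  \<open>0 < a < s\<close> and \<open>0 \<le> b < s\<close>. Singular fade states are ratios of such differences, so there are at
  most \<open>4 s\<^sup>2 (s - 1)\<^sup>2\<close> of them. For \<open>M\<close>-PSK with \<open>M = 2 H\<close> and \<open>w = exp (2 \<pi> i / M)\<close>, the numbers
  \<open>w\<^sup>m (w\<^sup>k - 1) / (w\<^sup>l - 1)\<close> with \<open>m < M\<close> and \<open>k \<noteq> l\<close> in \<open>{1..H}\<close> are \<open>M H (H - 1)\<close>
  pairwise distinct singular fade states: their moduli are the ratios \<open>sin (\<pi> k / M) / sin (\<pi> l / M)\<close>,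
  and an equality of two of these is a linear relation between four cosines of multiples of
  \<open>\<pi> / M\<close>, which is trivial because \<open>x\<^sup>M + 1\<close> is irreducible for \<open>M\<close> a power of two (Eisenstein
  after the shift by one).\<close>

section \<open>Eisenstein's criterion over the integers\<close>

text \<open>As \<open>p^2\<close> does not divide the constant coefficient of \<open>P\<close>, the
  prime \<open>p\<close> divides that of one factor only, say of \<open>f\<close>. At the least
  index \<open>i\<close> where \<open>p\<close> does not divide \<open>coeff f i\<close>, it does
  not divide \<open>coeff P i\<close> either. Hence \<open>i\<close> is at least
  \<open>degree P\<close>, and \<open>f\<close> takes up the whole degree.\<close>

lemma eisenstein:
  fixes P f g :: "int poly" and p :: int
  assumes p: "prime p"
    and lead: "\<not> p dvd lead_coeff P"
    and low: "\<And>i. i < degree P \<Longrightarrow> p dvd coeff P i"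
    and const: "\<not> p\<^sup>2 dvd coeff P 0"
    and P: "P = f * g"
  shows "degree f = 0 \<or> degree g = 0"
proof -
  have aux: "degree g = 0" if P: "P = f * g" and f0: "p dvd coeff f 0" for f g :: "int poly"
  proof -
    have "P \<noteq> 0" using lead by auto
    then have "f \<noteq> 0" "g \<noteq> 0" using P by auto
    have g0: "\<not> p dvd coeff g 0"
    proof
      assume "p dvd coeff g 0"
      with f0 have "p * p dvd coeff f 0 * coeff g 0" by (rule mult_dvd_mono)
      with const show False by (simp add: P coeff_mult_0 power2_eq_square)
    qed
    have ex: "\<not> p dvd lead_coeff f"
      using lead by (auto simp: P lead_coeff_mult)
    define i where "i = (LEAST i. \<not> p dvd coeff f i)"
    have i: "\<not> p dvd coeff f i"
      unfolding i_def by (rule LeastI) (rule ex)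
    have less: "p dvd coeff f j" if "j < i" for j
      using not_less_Least[of j "\<lambda>i. \<not> p dvd coeff f i"] that by (auto simp: i_def)
    have "coeff P i = (\<Sum>j\<le>i. coeff f j * coeff g (i - j))"
      by (simp add: P coeff_mult)
    also have "\<dots> = (\<Sum>j<i. coeff f j * coeff g (i - j)) + coeff f i * coeff g 0"
      by (simp flip: lessThan_Suc_atMost)
    finally have "coeff P i = (\<Sum>j<i. coeff f j * coeff g (i - j)) + coeff f i * coeff g 0" .
    moreover have "p dvd (\<Sum>j<i. coeff f j * coeff g (i - j))"
      using less by (intro dvd_sum) auto
    moreover have "\<not> p dvd coeff f i * coeff g 0"
      using p i g0 by (simp add: prime_dvd_mult_iff)
    ultimately have "\<not> p dvd coeff P i"
      by (simp add: dvd_add_right_iff)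
    then have "degree P \<le> i" using low by (meson not_le)
    moreover have "i \<le> degree f" using i by (intro le_degree) auto
    moreover have "degree P = degree f + degree g"
      using P \<open>f \<noteq> 0\<close> \<open>g \<noteq> 0\<close> by (simp add: degree_mult_eq)
    ultimately show ?thesis by simp
  qed
  \<comment> \<open>For constant \<open>P\<close> the assumption \<open>low\<close> says nothing
    about the constant coefficient, so that case is settled by degrees alone.\<close>
  show ?thesis
  proof (cases "degree P = 0")
    case True
    have "P \<noteq> 0" using lead by auto
    then have "degree P = degree f + degree g"
      unfolding P by (intro degree_mult_eq) auto
    then show ?thesis using True by simp
  next
    case False
    then have "p dvd coeff f 0 * coeff g 0"
      using low[of 0] by (simp add: P coeff_mult_0)
    then have "p dvd coeff f 0 \<or> p dvd coeff g 0"
      using p by (simp add: prime_dvd_mult_iff)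
    then show ?thesis
      using aux[of f g] aux[of g f] P by (auto simp: mult.commute)
  qed
qed

section \<open>Integer polynomials of least degree with a given root\<close>

text \<open>Coefficients stay integers, so that contents and divisibility by a prime make sense,
  while the argument may be a complex number.\<close>

definition int_poly_eval :: "int poly \<Rightarrow> 'a::field_char_0 \<Rightarrow> 'a" where
  "int_poly_eval f x = poly (map_poly of_int f) x"

lemma int_poly_eval_0 [simp]: "int_poly_eval 0 x = 0"
  and int_poly_eval_1 [simp]: "int_poly_eval 1 x = 1"
  and int_poly_eval_pCons [simp]: "int_poly_eval (pCons a f) x = of_int a + x * int_poly_eval f x"
  by (simp_all add: int_poly_eval_def map_poly_pCons)

lemma int_poly_eval_add [simp]: "int_poly_eval (f + g) x = int_poly_eval f x + int_poly_eval g x"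
  by (induction f g rule: poly_induct2) (simp_all add: algebra_simps)

lemma int_poly_eval_smult [simp]: "int_poly_eval (smult a f) x = of_int a * int_poly_eval f x"
  by (induction f) (simp_all add: algebra_simps)

lemma int_poly_eval_mult [simp]: "int_poly_eval (f * g) x = int_poly_eval f x * int_poly_eval g x"
  by (induction f) (simp_all add: algebra_simps)

lemma int_poly_eval_power [simp]: "int_poly_eval (f ^ n) x = int_poly_eval f x ^ n"
  by (induction n) simp_all

lemma int_poly_eval_monom [simp]: "int_poly_eval (monom a n) x = of_int a * x ^ n"
  by (induction n) (simp_all add: monom_0 monom_Suc algebra_simps)

lemma int_poly_eval_sum [simp]: "int_poly_eval (sum f A) x = (\<Sum>i\<in>A. int_poly_eval (f i) x)"
  by (induction A rule: infinite_finite_induct) simp_all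

lemma int_poly_eval_pcompose [simp]:
  "int_poly_eval (pcompose f g) x = int_poly_eval f (int_poly_eval g x)"
  by (induction f) (simp_all add: pcompose_pCons)

text \<open>The pseudo-remainder of \<open>P\<close> by \<open>h\<close> vanishes at
  \<open>x\<close> and is zero by minimality, so some multiple \<open>smult a P\<close> is divisible
  by \<open>h\<close>. By Gauss's lemma on contents, \<open>a\<close> divides the content of the
  quotient because \<open>h\<close> is primitive, and it cancels.\<close>

lemma int_poly_dvd_if_least_degree_root:
  fixes x :: "'a::field_char_0" and h P :: "int poly"
  assumes "h \<noteq> 0" "content h = 1" "int_poly_eval h x = 0" "int_poly_eval P x = 0"
    and least: "\<And>r. r \<noteq> 0 \<Longrightarrow> int_poly_eval r x = 0 \<Longrightarrow> degree h \<le> degree r"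
  shows "h dvd P"
proof -
  obtain a q where a: "a \<noteq> 0" and eq: "smult a P = h * q + pseudo_mod P h"
    using pseudo_mod(1)[OF \<open>h \<noteq> 0\<close>] by blast
  have "int_poly_eval (smult a P) x = int_poly_eval (h * q + pseudo_mod P h) x"
    by (simp only: eq)
  then have "int_poly_eval (pseudo_mod P h) x = 0" using assms by simp
  then have "pseudo_mod P h = 0"
    using pseudo_mod(2)[OF \<open>h \<noteq> 0\<close>, of P] least by fastforce
  then have eq: "smult a P = h * q" using eq by simp
  then have "content (smult a P) = content (h * q)" by simp
  then have "\<bar>a\<bar> * content P = content q" using assms(2) by (simp add: content_mult)
  then have "a dvd content q" by (metis abs_dvd_iff dvd_triv_left)
  then have "[:a:] dvd q" by (simp add: const_poly_dvd_iff_dvd_content)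
  then obtain q' where "q = smult a q'" by auto
  then have "smult a P = smult a (h * q')" using eq by simp
  then have "smult a (P - h * q') = 0" by (simp add: smult_diff_right)
  then have "P = h * q'" using a by simp
  then show ?thesis by simp
qed

text \<open>The primitive part of a polynomial of least degree vanishing at \<open>x\<close> divides
  \<open>P\<close> and is not constant. By Eisenstein's criterion its cofactor is constant, so the
  least degree is \<open>degree P\<close>.\<close>

lemma degree_ge_eisenstein:
  fixes x :: "'a::field_char_0" and P f :: "int poly" and p :: int
  assumes p: "prime p"
    and lead: "\<not> p dvd lead_coeff P"
    and low: "\<And>i. i < degree P \<Longrightarrow> p dvd coeff P i"
    and const: "\<not> p\<^sup>2 dvd coeff P 0"
    and Px: "int_poly_eval P x = 0"
    and f: "f \<noteq> 0" "int_poly_eval f x = 0"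
  shows "degree P \<le> degree f"
proof -
  let ?R = "\<lambda>r. r \<noteq> 0 \<and> int_poly_eval r x = 0"
  define g where "g = arg_min degree ?R"
  have g: "?R g" unfolding g_def by (rule arg_min_natI[of _ f]) (use f in simp)
  have least: "degree g \<le> degree r" if "?R r" for r
    unfolding g_def by (rule arg_min_nat_le) (fact that)
  define h where "h = primitive_part g"
  have "int_poly_eval g x = of_int (content g) * int_poly_eval h x"
    by (metis h_def content_times_primitive_part int_poly_eval_smult)
  then have hx: "int_poly_eval h x = 0" using g by auto
  have h: "h \<noteq> 0" "content h = 1" "degree h = degree g" using g by (auto simp: h_def)
  then have "h dvd P"
    using hx Px least by (intro int_poly_dvd_if_least_degree_root[of h x]) auto
  then obtain q where P: "P = h * q" by auto
  have "degree h \<noteq> 0"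
  proof
    assume "degree h = 0"
    then obtain c where "h = [:c:]" by (rule degree_eq_zeroE)
    then show False using h hx by simp
  qed
  then have "degree q = 0"
    using eisenstein[OF p lead low const P] by auto
  moreover have "degree P = degree h + degree q"
    using lead h P by (subst P, intro degree_mult_eq) auto
  ultimately show ?thesis using least f h by simp
qed

section \<open>The polynomial \<open>x ^ (2 ^ n) + 1\<close>\<close>

text \<open>The Frobenius identity modulo 2, by repeated squaring. It supplies the even coefficients
  that Eisenstein's criterion needs.\<close>

lemma one_plus_X_pow_two_pow:
  "\<exists>h :: int poly. [:1, 1:] ^ (2 ^ n) = monom 1 (2 ^ n) + 1 + smult 2 h"
proof (induction n)
  case 0
  have "[:1, 1:] ^ (2 ^ 0) = monom 1 (2 ^ 0) + 1 + smult 2 (0 :: int poly)"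
    by (simp add: monom_Suc one_pCons monom_0)
  then show ?case by blast
next
  case (Suc n)
  then obtain h :: "int poly" where h: "[:1, 1:] ^ (2 ^ n) = monom 1 (2 ^ n) + 1 + smult 2 h"
    by blast
  let ?m = "monom 1 (2 ^ n) :: int poly"
  have "[:1, 1:] ^ (2 ^ Suc n) = ([:1, 1:] ^ (2 ^ n))\<^sup>2"
    by (simp add: power_mult mult.commute flip: power_mult)
  also have "\<dots> = (?m + 1 + [:2:] * h)\<^sup>2" by (simp add: h)
  also have "\<dots> = ?m * ?m + 1 + [:2:] * (?m + [:2:] * h * h + ?m * h * [:2:] + [:2:] * h)"
    unfolding power2_eq_square
    by (simp add: algebra_simps flip: numeral_poly)
  also have "?m * ?m = monom 1 (2 ^ Suc n)" by (simp add: mult_monom flip: mult_2)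
  finally have "[:1, 1:] ^ (2 ^ Suc n) =
      monom 1 (2 ^ Suc n) + 1 + smult 2 (?m + [:2:] * h * h + ?m * h * [:2:] + [:2:] * h)"
    by simp
  then show ?case by (rule exI)
qed

text \<open>Substituting \<open>1 + x\<close> into \<open>x ^ (2 ^ n) + 1\<close> gives a polynomial
  that satisfies Eisenstein's criterion at 2 and has the root \<open>z - 1\<close>. The same shift
  of \<open>f\<close> keeps its degree.\<close>

lemma cyclotomic_two_pow_degree:
  fixes z :: "'a::field_char_0" and f :: "int poly"
  assumes z: "z ^ (2 ^ n) = -1" and f: "int_poly_eval f z = 0" "degree f < 2 ^ n"
  shows "f = 0"
proof (rule ccontr)
  assume "f \<noteq> 0"
  let ?M = "2 ^ n :: nat"
  define P :: "int poly" where "P = [:1, 1:] ^ ?M + 1"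
  obtain h :: "int poly" where h: "[:1, 1:] ^ ?M = monom 1 ?M + 1 + smult 2 h"
    using one_plus_X_pow_two_pow by blast
  have deg1: "degree ([:1, 1:] ^ ?M :: int poly) = ?M"
    by (simp add: degree_power_eq)
  have deg: "degree P = ?M"
    unfolding P_def by (subst degree_add_eq_left) (simp_all add: deg1)
  have "lead_coeff ([:1, 1:] ^ ?M :: int poly) = 1" by (simp add: lead_coeff_power)
  then have "lead_coeff P = 1"
    unfolding deg by (simp add: P_def deg1)
  have "coeff ([:1, 1:] ^ ?M :: int poly) 0 = 1" by (simp add: coeff_0_power)
  then have c0: "coeff P 0 = 2" by (simp add: P_def)
  \<comment> \<open>The two constants 1 add up, so \<open>P\<close> is \<open>monom 1 ?M\<close>
    plus an even polynomial.\<close>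
  have even: "2 dvd coeff P i" if "i < ?M" for i
    using that unfolding P_def h by (cases i) (auto simp: numeral_poly)
  have "?M = degree P" by (simp add: deg)
  also have "\<dots> \<le> degree (pcompose f [:1, 1:])"
  proof (rule degree_ge_eisenstein[of 2 P "z - 1"])
    show "int_poly_eval P (z - 1) = 0" using z by (simp add: P_def)
    show "pcompose f [:1, 1:] \<noteq> 0" using \<open>f \<noteq> 0\<close> by (simp add: pcompose_eq_0_iff)
    show "int_poly_eval (pcompose f [:1, 1:]) (z - 1) = 0" using f by simp
  qed (use deg \<open>lead_coeff P = 1\<close> c0 even in auto)
  also have "\<dots> = degree f" by (simp add: degree_pcompose)
  finally show False using f by simp
qed

section \<open>Linear relations between cosines and ratios of sines\<close>

text \<open>Twice a cosine is \<open>z^j + z^(-j)\<close> with \<open>z^(2 * H) = -1\<close>, so a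
  relation becomes an integer polynomial with root \<open>z\<close>. Indices from \<open>H\<close>
  on would only add zero and the same numbers up to sign.\<close>

lemma cos_linear_independent:
  fixes c :: "nat \<Rightarrow> int"
  assumes H: "H = 2 ^ n"
    and sum0: "(\<Sum>j<H. of_int (c j) * cos (pi * real j / (2 * real H))) = 0"
    and "i < H"
  shows "c i = 0"
proof -
  define z where "z = cis (pi / (2 * real H))"
  have "H > 0" using H by simp
  have zp: "z ^ k = cis (pi * real k / (2 * real H))" for k
    unfolding z_def Complex.DeMoivre by (simp add: field_simps)
  have z: "z ^ (2 ^ Suc n) = -1"
    using \<open>H > 0\<close> by (simp add: zp H)
  \<comment> \<open>Multiplying the relation by \<open>z\<^sup>H\<close> clears the negative exponents and keeps the degree below \<open>2 * H\<close>.\<close>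
  define f where "f = (\<Sum>j<H. monom (c j) (H + j) + monom (c j) (H - j))"
  have "degree f < 2 ^ Suc n"
    unfolding f_def using H
    by (intro degree_sum_less le_less_trans[OF degree_add_le_max])
       (auto intro!: le_less_trans[OF degree_monom_le])
  have pair: "z ^ (H + j) + z ^ (H - j) = z ^ H * of_real (2 * cos (pi * real j / (2 * real H)))"
    if "j < H" for j
  proof -
    have "z ^ (H - j) = z ^ H * cis (- (pi * real j / (2 * real H)))"
      unfolding zp cis_mult using that \<open>H > 0\<close> by (simp add: of_nat_diff field_simps)
    moreover have "z ^ (H + j) = z ^ H * cis (pi * real j / (2 * real H))"
      by (simp add: power_add zp)
    ultimately show ?thesis
      by (simp add: complex_eq_iff algebra_simps)
  qed
  have "int_poly_eval f z = (\<Sum>j<H. of_int (c j) * (z ^ (H + j) + z ^ (H - j)))"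
    by (simp add: f_def algebra_simps)
  also have "\<dots> = (\<Sum>j<H. 2 * z ^ H * of_real (of_int (c j) * cos (pi * real j / (2 * real H))))"
    by (intro sum.cong) (simp_all add: pair mult_ac)
  also have "\<dots> = 2 * z ^ H * of_real (\<Sum>j<H. of_int (c j) * cos (pi * real j / (2 * real H)))"
    by (simp only: sum_distrib_left of_real_sum)
  also have "\<dots> = 0" by (simp only: sum0) simp
  finally have "int_poly_eval f z = 0" .
  then have "f = 0"
    using cyclotomic_two_pow_degree[OF z] \<open>degree f < 2 ^ Suc n\<close> by blast
  then have "0 = coeff f (H + i)" by simp
  \<comment> \<open>The two monomials coincide only for \<open>j = 0\<close>, where the coefficient
    is doubled.\<close>
  also have "\<dots> = (\<Sum>j<H. (if j = i then c j else 0) + (if j = 0 \<and> i = 0 then c j else 0))"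
    unfolding f_def coeff_sum using \<open>H > 0\<close> by (intro sum.cong) auto
  also have "\<dots> = c i + (if i = 0 then c 0 else 0)"
    using \<open>i < H\<close> by (simp add: sum.distrib)
  finally show ?thesis by (auto split: if_splits)
qed

text \<open>Here \<open>v a\<close> is the coordinate vector of \<open>cos (\<pi> a / (2 H))\<close> with respect to the independent
  numbers \<open>cos (\<pi> j / (2 H))\<close>, \<open>j < H\<close>; the truncated \<open>2 * H - a\<close> is the reflected index, as
  \<open>a \<le> 2 * H\<close> wherever it matters.\<close>

lemma reflected_indicators_cancel:
  fixes a b c d H :: nat and v :: "nat \<Rightarrow> nat \<Rightarrow> int"
  assumes v0: "\<And>j. j < H \<Longrightarrow> v a j + v d j - v b j - v c j = 0"
    and v: "\<And>a j. v a j = (if j = a then 1 else 0) - (if j = 2 * H - a then 1 else 0)"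
    and le: "a \<le> 2 * H" "b \<le> 2 * H" "c \<le> 2 * H" "d \<le> 2 * H"
  shows "a = b \<and> d = c \<or> a = c \<and> d = b \<or> a + d = 2 * H \<and> b + c = 2 * H"
proof -
  have pos: "v x x = 1" if "x < H" for x using that by (simp add: v)
  have neg: "v x (2 * H - x) = -1" if "2 * H - x < H" for x using that by (simp add: v)
  have le1: "v x j \<le> 0" if "x \<noteq> j" for x j using that by (simp add: v)
  have ge1: "v x j \<ge> 0" if "j \<noteq> 2 * H - x" for x j using that by (simp add: v)
  have H0: "v H j = 0" for j by (simp add: v)
  have neq: "2 * H - x \<noteq> 2 * H - y" if "x \<noteq> y" "x \<le> 2 * H" "y \<le> 2 * H" for x y
    using that by linarith
  \<comment> \<open>The vector \<open>v x\<close> determines \<open>x\<close>: if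
    \<open>x < H\<close>, only \<open>v x\<close> has entry 1 at \<open>x\<close>; if
    \<open>2 * H - x < H\<close>, only \<open>v x\<close> has entry -1 there. The one remaining
    index \<open>H\<close> gives the zero vector.\<close>
  have cancel: "x = y" if eq: "\<And>j. j < H \<Longrightarrow> v x j = v y j" and "x \<le> 2 * H" "y \<le> 2 * H" for x y
  proof (rule ccontr)
    assume "x \<noteq> y"
    have "x < H \<or> 2 * H - x < H \<or> x = H \<and> y < H \<or> x = H \<and> 2 * H - y < H"
      using \<open>x \<noteq> y\<close> that(2,3) by linarith
    then consider "x < H" | "2 * H - x < H" | "x = H" "y < H" | "x = H" "2 * H - y < H"
      by blast
    then show False
    proof cases
      case 1
      then show False using eq[of x] pos[of x] le1[of y x] \<open>x \<noteq> y\<close> by simp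
    next
      case 2
      then show False
        using eq[of "2 * H - x"] neg[of x] ge1[of "2 * H - x" y] neq[OF \<open>x \<noteq> y\<close>] that(2,3) by simp
    next
      case 3
      then show False using eq[of y] pos[of y] H0 by simp
    next
      case 4
      then show False using eq[of "2 * H - y"] neg[of y] H0 by simp
    qed
  qed
  have refl: "v (2 * H - x) j = - v x j" if "x \<le> 2 * H" for x j
    using that by (simp add: v)
  consider "a = b" | "a = c" | "a + d = 2 * H" | "a \<noteq> b" "a \<noteq> c" "a + d \<noteq> 2 * H" by blast
  then show ?thesis
  proof cases
    case 1
    then have "v d j = v c j" if "j < H" for j using v0[OF that] by simp
    then have "d = c" using le by (intro cancel)
    then show ?thesis using 1 by simp
  next
    case 2
    then have "v d j = v b j" if "j < H" for j using v0[OF that] by simp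
    then have "d = b" using le by (intro cancel)
    then show ?thesis using 2 by simp
  next
    case 3
    then have "d = 2 * H - a" by simp
    then have "v (2 * H - b) j = v c j" if "j < H" for j
      using v0[OF that] refl[OF le(1)] refl[OF le(2)] by simp
    then have "2 * H - b = c" using le by (intro cancel) simp_all
    then show ?thesis using 3 le by linarith
  next
    case 4
    \<comment> \<open>Otherwise \<open>v a\<close> has a nonzero entry below \<open>H\<close>, and
      there the other three terms cannot contribute with the opposite sign.\<close>
    have "a = H"
    proof (rule ccontr)
      assume "a \<noteq> H"
      then have "a < H \<or> 2 * H - a < H" using le(1) by linarith
      then consider "a < H" | "2 * H - a < H" by blast
      then show False
      proof cases
        case 1
        have "a \<noteq> 2 * H - d" using 4(3) le by linarith
        then show False
          using v0[OF 1] pos[OF 1] ge1[of a d] le1[of b a] le1[of c a] 4 by simp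
      next
        case 2
        have "d \<noteq> 2 * H - a" using 4(3) le by linarith
        then show False
          using v0[OF 2] neg[OF 2] le1[of d "2 * H - a"] ge1[of "2 * H - a" b] ge1[of "2 * H - a" c]
            neq[OF 4(1)] neq[OF 4(2)] le by simp
      qed
    qed
    then have *: "v d j = v b j + v c j" if "j < H" for j using v0[OF that] H0[of j] by simp
    \<comment> \<open>The same sign argument applies to \<open>v d = v b + v c\<close>. Afterwards
      the vector left over is zero, so its index is \<open>H = a\<close>, against the case
      assumption.\<close>
    have "d = b \<or> d = c"
    proof (rule ccontr)
      assume nd: "\<not> (d = b \<or> d = c)"
      have "d \<noteq> H" using 4 \<open>a = H\<close> by simp
      then have "d < H \<or> 2 * H - d < H" using le(4) by linarith
      then consider "d < H" | "2 * H - d < H" by blast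
      then show False
      proof cases
        case 1
        then show False using *[OF 1] pos[OF 1] le1[of b d] le1[of c d] nd by simp
      next
        case 2
        then show False
          using *[OF 2] neg[OF 2] ge1[of "2 * H - d" b] ge1[of "2 * H - d" c]
            neq[of d b] neq[of d c] nd le by simp
      qed
    qed
    then show ?thesis
    proof
      assume "d = b"
      then have "v c j = v H j" if "j < H" for j using *[OF that] H0 by simp
      then have "c = H" using le by (intro cancel) simp_all
      then show ?thesis using 4 \<open>a = H\<close> by simp
    next
      assume "d = c"
      then have "v b j = v H j" if "j < H" for j using *[OF that] H0 by simp
      then have "b = H" using le by (intro cancel) simp_all
      then show ?thesis using 4 \<open>a = H\<close> by simp
    qed
  qed
qed

text \<open>Each cosine has at most one nonzero coordinate, 1 or -1, in the independent family, so
  coordinates can be compared. In the last alternative both sums vanish, since reflected angles have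
  opposite cosines.\<close>

lemma cos_sum_pairs_eq:
  assumes H: "H = 2 ^ n"
    and le: "a \<le> 2 * H" "b \<le> 2 * H" "c \<le> 2 * H" "d \<le> 2 * H"
    and eq: "cos (pi * real a / (2 * real H)) + cos (pi * real d / (2 * real H)) =
      cos (pi * real b / (2 * real H)) + cos (pi * real c / (2 * real H))"
  shows "a = b \<and> d = c \<or> a = c \<and> d = b \<or> a + d = 2 * H \<and> b + c = 2 * H"
proof -
  have "H > 0" using H by simp
  define C where "C j = cos (pi * real j / (2 * real H))" for j
  define v :: "nat \<Rightarrow> nat \<Rightarrow> int" where
    "v a j = (if j = a then 1 else 0) - (if j = 2 * H - a then 1 else 0)" for a j
  have expand: "(\<Sum>j<H. of_int (v a j) * C j) = C a" if a: "a \<le> 2 * H" for a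
  proof -
    have sum: "(\<Sum>j<H. of_int (v a j) * C j) =
        (if a < H then C a else 0) - (if 2 * H - a < H then C (2 * H - a) else 0)"
    proof -
      have "(\<Sum>j<H. of_int (v a j) * C j) =
          (\<Sum>j<H. (if j = a then C a else 0) - (if j = 2 * H - a then C (2 * H - a) else 0))"
        by (intro sum.cong) (auto simp: v_def)
      then show ?thesis by (simp add: sum_subtractf)
    qed
    have refl: "C (2 * H - a) = - C a"
    proof -
      have "pi * real (2 * H - a) / (2 * real H) = pi - pi * real a / (2 * real H)"
        using a \<open>H > 0\<close> by (simp add: of_nat_diff field_simps)
      then show ?thesis by (simp add: C_def cos_diff)
    qed
    have "C H = 0" using \<open>H > 0\<close> by (simp add: C_def)
    then show ?thesis
      unfolding sum using a by (cases a H rule: linorder_cases) (auto simp: refl)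
  qed
  have "(\<Sum>j<H. of_int (v a j + v d j - v b j - v c j) * C j) =
      (\<Sum>j<H. of_int (v a j) * C j) + (\<Sum>j<H. of_int (v d j) * C j) -
      (\<Sum>j<H. of_int (v b j) * C j) - (\<Sum>j<H. of_int (v c j) * C j)"
    by (simp add: ring_distribs sum.distrib sum_subtractf)
  also have "\<dots> = C a + C d - C b - C c" by (simp only: expand le)
  also have "\<dots> = 0" using eq by (simp add: C_def)
  finally have v0: "v a j + v d j - v b j - v c j = 0" if "j < H" for j
    using cos_linear_independent[OF H _ that, of "\<lambda>j. v a j + v d j - v b j - v c j"]
    by (simp add: C_def)
  show ?thesis using v0 v_def le by (rule reflected_indicators_cancel)
qed

text \<open>Product-to-sum formulas give a relation between four cosines. Its first solution is
  impossible for positive indices. In the other two, \<open>k, l'\<close> and \<open>k', l\<close>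
  agree up to order, and \<open>k \<noteq> l\<close> excludes the swap.\<close>

lemma sin_ratio_inj:
  assumes H: "H = 2 ^ n"
    and mem: "k \<in> {1..H}" "l \<in> {1..H}" "k' \<in> {1..H}" "l' \<in> {1..H}"
    and ne: "k \<noteq> l"
    and eq: "sin (pi * real k / (2 * real H)) * sin (pi * real l' / (2 * real H)) =
      sin (pi * real k' / (2 * real H)) * sin (pi * real l / (2 * real H))"
  shows "k = k' \<and> l = l'"
proof -
  let ?d = "\<lambda>i j. nat \<bar>int i - int j\<bar>"
  have prod: "2 * (sin (pi * real i / (2 * real H)) * sin (pi * real j / (2 * real H))) =
      cos (pi * real (?d i j) / (2 * real H)) - cos (pi * real (i + j) / (2 * real H))" for i j
  proof -
    have "cos (pi * real (?d i j) / (2 * real H)) =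
        cos (pi * real i / (2 * real H) - pi * real j / (2 * real H))"
    proof (cases "i \<le> j")
      case True
      then have "pi * real (?d i j) / (2 * real H) =
          - (pi * real i / (2 * real H) - pi * real j / (2 * real H))"
        by (simp add: nat_diff_distrib of_nat_diff diff_divide_distrib algebra_simps)
      then show ?thesis by (simp only: cos_minus)
    next
      case False
      then have "pi * real (?d i j) / (2 * real H) =
          pi * real i / (2 * real H) - pi * real j / (2 * real H)"
        by (simp add: nat_diff_distrib of_nat_diff diff_divide_distrib algebra_simps)
      then show ?thesis by simp
    qed
    moreover have "pi * real (i + j) / (2 * real H) =
        pi * real i / (2 * real H) + pi * real j / (2 * real H)"
      by (simp add: add_divide_distrib algebra_simps)
    ultimately show ?thesis by (simp only: sin_times_sin) simp
  qed
  have cos_eq: "cos (pi * real (?d k l') / (2 * real H)) + cos (pi * real (k' + l) / (2 * real H)) =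
      cos (pi * real (k + l') / (2 * real H)) + cos (pi * real (?d k' l) / (2 * real H))"
    using eq prod[of k l'] prod[of k' l] by linarith
  have mem': "0 < k" "0 < l" "0 < k'" "0 < l'" "k \<le> H" "l \<le> H" "k' \<le> H" "l' \<le> H"
    using mem by auto
  have "?d k l' = k + l' \<and> k' + l = ?d k' l \<or> ?d k l' = ?d k' l \<and> k' + l = k + l' \<or>
      ?d k l' + (k' + l) = 2 * H \<and> k + l' + ?d k' l = 2 * H"
    by (rule cos_sum_pairs_eq[OF H _ _ _ _ cos_eq]) (use mem in auto)
  then show ?thesis
  proof (elim disjE conjE)
    assume "nat \<bar>int k - int l'\<bar> = k + l'"
    then show ?thesis using mem' by linarith
  next
    assume "nat \<bar>int k - int l'\<bar> = nat \<bar>int k' - int l\<bar>" "k' + l = k + l'"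
    then show ?thesis using mem' ne by linarith
  next
    assume "nat \<bar>int k - int l'\<bar> + (k' + l) = 2 * H" "k + l' + nat \<bar>int k' - int l\<bar> = 2 * H"
    then show ?thesis using mem' ne by linarith
  qed
qed

section \<open>Singular fade states as ratios of differences\<close>

text \<open>The cardinality drops exactly when \<open>(x, y)\<close> to \<open>x + z * y\<close>
  fails to be injective. A collision of distinct pairs has \<open>y \<noteq> y'\<close>, because
  equal second components force equal first ones.\<close>

lemma singular_fade_states_eq:
  fixes S :: "complex set"
  assumes "finite S"
  shows "singular_fade_states S =
    {z. z \<noteq> 0 \<and> (\<exists>x\<in>S. \<exists>x'\<in>S. \<exists>y\<in>S. \<exists>y'\<in>S. y \<noteq> y' \<and> z * (y - y') = x' - x)}"
proof (intro set_eqI)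
  fix z :: complex
  let ?g = "\<lambda>(x, y). x + z * y"
  have im: "effective_constellation S z = ?g ` (S \<times> S)"
    by (auto simp: effective_constellation_def image_iff)
  have fin: "finite (S \<times> S)" using assms by simp
  have "card (effective_constellation S z) < (card S)\<^sup>2 \<longleftrightarrow> \<not> inj_on ?g (S \<times> S)"
    using card_image_le[OF fin, of ?g] inj_on_iff_eq_card[OF fin, of ?g]
    by (auto simp: im card_cartesian_product power2_eq_square)
  also have "\<not> inj_on ?g (S \<times> S) \<longleftrightarrow>
      (\<exists>x\<in>S. \<exists>x'\<in>S. \<exists>y\<in>S. \<exists>y'\<in>S. y \<noteq> y' \<and> z * (y - y') = x' - x)"
  proof -
    have eq: "?g (x, y) = ?g (x', y') \<longleftrightarrow> z * (y - y') = x' - x" for x x' y y'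
      by (auto simp: algebra_simps)
    show ?thesis
    proof
      assume "\<not> inj_on ?g (S \<times> S)"
      then obtain x y x' y' where mem: "x \<in> S" "y \<in> S" "x' \<in> S" "y' \<in> S"
        and ne: "(x, y) \<noteq> (x', y')" and "?g (x, y) = ?g (x', y')"
        unfolding inj_on_def by blast
      then have "z * (y - y') = x' - x" by (simp only: eq)
      moreover from this have "y \<noteq> y'" using ne by auto
      ultimately show "\<exists>x\<in>S. \<exists>x'\<in>S. \<exists>y\<in>S. \<exists>y'\<in>S. y \<noteq> y' \<and> z * (y - y') = x' - x"
        using mem by blast
    next
      assume "\<exists>x\<in>S. \<exists>x'\<in>S. \<exists>y\<in>S. \<exists>y'\<in>S. y \<noteq> y' \<and> z * (y - y') = x' - x"
      then obtain x y x' y' where mem: "x \<in> S" "y \<in> S" "x' \<in> S" "y' \<in> S"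
        and ne: "y \<noteq> y'" and "z * (y - y') = x' - x"
        by blast
      then have "?g (x, y) = ?g (x', y')" by (simp only: eq)
      then show "\<not> inj_on ?g (S \<times> S)"
        using inj_onD[of ?g "S \<times> S" "(x, y)" "(x', y')"] mem ne by auto
    qed
  qed
  finally show "z \<in> singular_fade_states S \<longleftrightarrow> z \<in> {z. z \<noteq> 0 \<and>
      (\<exists>x\<in>S. \<exists>x'\<in>S. \<exists>y\<in>S. \<exists>y'\<in>S. y \<noteq> y' \<and> z * (y - y') = x' - x)}"
    by (simp add: singular_fade_states_def fade_state_def)
qed

section \<open>Lower bound for PSK\<close>

text \<open>The modulus of \<open>E m * (E k - 1) / (E l - 1)\<close> determines \<open>k\<close>
  and \<open>l\<close>, and then the value determines \<open>m\<close>. Pairs with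
  \<open>k = l\<close> are left out, as they all give modulus 1.\<close>

lemma card_singular_fade_states_psk_ge:
  assumes H: "H = 2 ^ n"
  shows "H * (H - 1) * (2 * H) \<le> card (singular_fade_states (psk (2 * H)))"
proof -
  have "H > 0" using H by simp
  define E where "E j = exp (2 * complex_of_real pi * \<i> * of_nat j / of_nat (2 * H))" for j
  have E_eq: "E i = E j \<longleftrightarrow> i mod (2 * H) = j mod (2 * H)" for i j
    unfolding E_def using \<open>H > 0\<close> by (intro complex_root_unity_eq) simp
  have E_add: "E (i + j) = E i * E j" for i j
    by (simp add: E_def add_divide_distrib ring_distribs flip: exp_add)
  have E_cis: "E j = exp (\<i> * of_real (2 * (pi * real j / (2 * real H))))" for j
    by (simp add: E_def field_simps)
  have norm_E: "norm (E j) = 1" for j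
    unfolding E_cis by simp
  have norm_E1: "norm (E j - 1) = 2 * sin (pi * real j / (2 * real H))" if "j \<le> H" for j
  proof -
    have "sin (pi * real j / (2 * real H)) \<ge> 0"
      using that \<open>H > 0\<close> by (intro sin_ge_zero) (simp_all add: field_simps mult_left_mono)
    moreover have "norm (exp (\<i> * of_real (2 * x)) - 1) = 2 * \<bar>sin x\<bar>" for x
      by (subst dist_exp_i_1) simp
    ultimately show ?thesis by (simp only: E_cis abs_of_nonneg)
  qed
  \<comment> \<open>Exponents such as \<open>m + k\<close> may exceed \<open>2 * H\<close>, hence
    the reduction.\<close>
  have E_psk: "E j \<in> psk (2 * H)" for j
  proof -
    have "E j = E (j mod (2 * H))" by (simp add: E_eq)
    then show ?thesis using \<open>H > 0\<close> by (auto simp: psk_def E_def intro!: exI[of _ "j mod (2 * H)"])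
  qed
  have E0: "E 0 = 1" by (simp add: E_def)
  have E_ne: "E j \<noteq> 1" if "j \<in> {1..H}" for j
    using E_eq[of j 0] that \<open>H > 0\<close> by (auto simp: E0)
  let ?A = "(SIGMA k:{1..H}. {1..H} - {k}) \<times> {..<2 * H}"
  define F where "F = (\<lambda>((k, l), m). E m * (E k - 1) / (E l - 1))"
  have sub: "F ` ?A \<subseteq> singular_fade_states (psk (2 * H))"
  proof (rule image_subsetI)
    fix u assume u: "u \<in> ?A"
    obtain k l m where um: "u = ((k, l), m)" by (metis surj_pair)
    have kl: "k \<in> {1..H}" "l \<in> {1..H}" using u by (auto simp: um)
    let ?z = "E m * (E k - 1) / (E l - 1)"
    have "?z \<noteq> 0" using E_ne kl norm_E[of m] by auto
    \<comment> \<open>The colliding signal points are \<open>E m\<close>, \<open>E (m + k)\<close>,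
      \<open>E l\<close> and \<open>E 0\<close>.\<close>
    moreover have "?z * (E l - E 0) = E m * (E k - 1)"
      using E_ne kl by (simp add: E0)
    then have "?z * (E l - E 0) = E (m + k) - E m"
      by (simp add: E_add right_diff_distrib)
    moreover have "E l \<noteq> E 0" using E_ne kl by (simp add: E0)
    ultimately have "?z \<in> singular_fade_states (psk (2 * H))"
      unfolding singular_fade_states_eq[OF finite_psk] using E_psk by blast
    then show "F u \<in> singular_fade_states (psk (2 * H))" by (simp add: um F_def)
  qed
  have "inj_on F ?A"
  proof (rule inj_onI)
    fix u u' assume u: "u \<in> ?A" "u' \<in> ?A" "F u = F u'"
    obtain k l m where um: "u = ((k, l), m)" by (metis surj_pair)
    obtain k' l' m' where um': "u' = ((k', l'), m')" by (metis surj_pair)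
    have mem: "k \<in> {1..H}" "l \<in> {1..H}" "k' \<in> {1..H}" "l' \<in> {1..H}" "k \<noteq> l" "m < 2 * H" "m' < 2 * H"
      using u by (auto simp: um um')
    have eq: "E m * (E k - 1) * (E l' - 1) = E m' * (E k' - 1) * (E l - 1)"
      using u(3) E_ne mem by (simp add: um um' F_def frac_eq_eq)
    then have "norm (E m * (E k - 1) * (E l' - 1)) = norm (E m' * (E k' - 1) * (E l - 1))"
      by simp
    then have "k = k' \<and> l = l'"
      using mem by (intro sin_ratio_inj[OF H]) (simp_all add: norm_mult norm_E norm_E1)
    moreover from this have "E m = E m'"
      using eq E_ne mem by simp
    ultimately show "u = u'" using mem by (simp add: um um' E_eq)
  qed
  then have "card ?A = card (F ` ?A)" by (simp add: card_image)
  also have "\<dots> \<le> card (singular_fade_states (psk (2 * H)))"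
    using sub finite_singular_fade_states[OF finite_psk] by (rule card_mono[rotated])
  also have "card ?A = H * (H - 1) * (2 * H)"
    by (simp add: card_cartesian_product)
  finally show ?thesis by simp
qed

section \<open>Upper bound for square QAM\<close>

lemma square_qam_diff:
  assumes "x \<in> square_qam (s\<^sup>2)" "x' \<in> square_qam (s\<^sup>2)"
  obtains u v :: int where "\<bar>u\<bar> < int s" "\<bar>v\<bar> < int s" "x' - x = 2 * (of_int u + \<i> * of_int v)"
proof -
  have *: "\<exists>u::int. \<bar>u\<bar> < int s \<and> a' - a = 2 * of_int u"
    if a: "a \<in> pam_points (s\<^sup>2)" "a' \<in> pam_points (s\<^sup>2)" for a a'
  proof -
    obtain n n' where n: "a = - (real s - 1) + 2 * real n" "real n \<le> real s - 1"
      "a' = - (real s - 1) + 2 * real n'" "real n' \<le> real s - 1"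
      using a by (auto simp: pam_points_def)
    then have "n < s" "n' < s" by linarith+
    then show ?thesis using n by (intro exI[of _ "int n' - int n"]) auto
  qed
  obtain a b a' b' where x: "x = of_real a + \<i> * of_real b" "x' = of_real a' + \<i> * of_real b'"
    and ab: "a \<in> pam_points (s\<^sup>2)" "b \<in> pam_points (s\<^sup>2)"
      "a' \<in> pam_points (s\<^sup>2)" "b' \<in> pam_points (s\<^sup>2)"
    using assms by (auto simp: square_qam_def)
  obtain u v :: int where uv: "\<bar>u\<bar> < int s" "\<bar>v\<bar> < int s" "a' - a = 2 * of_int u" "b' - b = 2 * of_int v"
    using *[OF ab(1,3)] *[OF ab(2,4)] by blast
  have "x' - x = of_real (a' - a) + \<i> * of_real (b' - b)"
    by (simp add: x algebra_simps)
  then show ?thesis using that[OF uv(1,2)] by (simp add: uv(3,4) algebra_simps)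
qed

text \<open>Quarter turns carry the half-open quadrant \<open>a > 0\<close>,
  \<open>b \<ge> 0\<close> onto the rest of the punctured plane.\<close>

lemma gaussian_int_unit_quadrant:
  fixes u v :: int
  assumes "\<bar>u\<bar> < int s" "\<bar>v\<bar> < int s" "u \<noteq> 0 \<or> v \<noteq> 0"
  obtains e a b where "e \<in> {1, \<i>, -1, -\<i>}" "a \<in> {1..<s}" "b < s"
    "of_int u + \<i> * of_int v = e * (of_nat a + \<i> * of_nat b)"
proof -
  consider "u > 0" "v \<ge> 0" | "u \<le> 0" "v > 0" | "u < 0" "v \<le> 0" | "u \<ge> 0" "v < 0"
    using assms by linarith
  then show ?thesis
  proof cases
    case 1
    then show ?thesis using assms by (intro that[of 1 "nat u" "nat v"]) auto
  next
    case 2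
    then show ?thesis using assms
      by (intro that[of \<i> "nat v" "nat (- u)"]) (auto simp: algebra_simps)
  next
    case 3
    then show ?thesis using assms
      by (intro that[of "-1" "nat (- u)" "nat (- v)"]) (auto simp: algebra_simps)
  next
    case 4
    then show ?thesis using assms
      by (intro that[of "-\<i>" "nat (- v)" "nat u"]) (auto simp: algebra_simps)
  qed
qed

text \<open>In a ratio of two differences the factors 2 cancel and the two units merge into one, so
  the units contribute a factor 4 and not 16.\<close>

lemma card_singular_fade_states_square_qam_le:
  "card (singular_fade_states (square_qam (s\<^sup>2))) \<le> 4 * ((s - 1) * s)\<^sup>2"
proof -
  let ?U = "{1, \<i>, -1, -\<i>}" and ?B = "{1..<s} \<times> {..<s}"
  let ?q = "\<lambda>(a, b). of_nat a + \<i> * of_nat b :: complex"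
  let ?f = "\<lambda>(e, w, w'). e * ?q w / ?q w'"
  have diff: "\<exists>e\<in>?U. \<exists>w\<in>?B. x' - x = 2 * (e * ?q w)"
    if xx: "x \<in> square_qam (s\<^sup>2)" "x' \<in> square_qam (s\<^sup>2)" "x \<noteq> x'" for x x'
  proof -
    obtain u v :: int where uv: "\<bar>u\<bar> < int s" "\<bar>v\<bar> < int s" "x' - x = 2 * (of_int u + \<i> * of_int v)"
      using square_qam_diff xx(1,2) by blast
    have "u \<noteq> 0 \<or> v \<noteq> 0" using uv(3) xx(3) by auto
    then obtain e a b where *: "e \<in> ?U" "a \<in> {1..<s}" "b < s"
      "of_int u + \<i> * of_int v = e * (of_nat a + \<i> * of_nat b)"
      using gaussian_int_unit_quadrant uv(1,2) by blast
    then have "(a, b) \<in> ?B" "x' - x = 2 * (e * ?q (a, b))" using uv(3) by auto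
    then show ?thesis using *(1) by blast
  qed
  have unit: "e / e' \<in> ?U" if "e \<in> ?U" "e' \<in> ?U" for e e'
    using that by auto
  have "singular_fade_states (square_qam (s\<^sup>2)) \<subseteq> ?f ` (?U \<times> ?B \<times> ?B)"
  proof
    fix z assume "z \<in> singular_fade_states (square_qam (s\<^sup>2))"
    then obtain x x' y y' where z: "z \<noteq> 0" "y \<noteq> y'" "z * (y - y') = x' - x"
      and mem: "x \<in> square_qam (s\<^sup>2)" "x' \<in> square_qam (s\<^sup>2)" "y \<in> square_qam (s\<^sup>2)" "y' \<in> square_qam (s\<^sup>2)"
      unfolding singular_fade_states_eq[OF finite_square_qam] by blast
    have "x \<noteq> x'" using z by auto
    then obtain e w where w: "e \<in> ?U" "w \<in> ?B" "x' - x = 2 * (e * ?q w)"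
      using diff mem by blast
    obtain e' w' where w': "e' \<in> ?U" "w' \<in> ?B" "y - y' = 2 * (e' * ?q w')"
      using diff[OF mem(4,3)] z(2) by blast
    have "y - y' \<noteq> 0" using z(2) by simp
    then have "z = (x' - x) / (y - y')" by (simp flip: z(3))
    also have "\<dots> = (e / e') * ?q w / ?q w'" by (simp add: w(3) w'(3))
    finally have "z = ?f (e / e', w, w')" by simp
    then show "z \<in> ?f ` (?U \<times> ?B \<times> ?B)"
      using unit[OF w(1) w'(1)] w(2) w'(2) by blast
  qed
  then have "card (singular_fade_states (square_qam (s\<^sup>2))) \<le> card (?f ` (?U \<times> ?B \<times> ?B))"
    by (intro card_mono) auto
  also have "\<dots> \<le> card (?U \<times> ?B \<times> ?B)" by (intro card_image_le) auto
  also have "\<dots> = card ?U * ((s - 1) * s)\<^sup>2"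
    by (simp only: card_cartesian_product card_atLeastLessThan card_lessThan power2_eq_square)
  also have "card ?U \<le> 4" by (intro order_trans[OF card_insert_le_m1]) auto
  finally show ?thesis by simp
qed

section \<open>Comparison of the two bounds\<close>

text \<open>The exponent starts at 2 because for \<open>M = 4\<close> the two counts are equal, by
  \<open>singular_fade_states_4\<close>.\<close>

theorem mainTheorem3:
  fixes M lam :: nat
  assumes "lam \<ge> 2"
    and "M = 2 ^ (2 * lam)"
  shows "card (singular_fade_states (square_qam M)) < card (singular_fade_states (psk M))"
proof -
  define s H :: nat where "s = 2 ^ lam" and "H = 2 ^ (2 * lam - 1)"
  have Ms: "M = s\<^sup>2" by (simp add: assms(2) s_def power_mult mult.commute)
  have MH: "M = 2 * H"
    using assms by (simp add: H_def flip: power_Suc)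
  have "2 ^ 2 \<le> s" unfolding s_def using assms(1) by (intro power_increasing) auto
  then have s: "s \<ge> 4" by simp
  have "s * s = 2 * H" using Ms MH by (simp add: power2_eq_square)
  have "4 * ((s - 1) * s)\<^sup>2 < H * (H - 1) * (2 * H)"
  proof -
    \<comment> \<open>The shift by 4 replaces the truncated \<open>s - 1\<close> by
      \<open>t + 3\<close>. The common factor \<open>s * s = 2 * H\<close> cancels, which leaves
      \<open>4 * (s - 1)^2 < H * (H - 1)\<close>.\<close>
    obtain t where t: "s = t + 4" using s le_Suc_ex by (metis add.commute)
    have "int (s * s) = int (2 * H)" using \<open>s * s = 2 * H\<close> by simp
    then have sq: "2 * int H = (int t + 4)\<^sup>2" by (simp add: t power2_eq_square)
    have "4 * (int t + 3)\<^sup>2 < int H * (int H - 1)"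
    proof -
      have "(int t + 3)\<^sup>2 = 2 * int H - 2 * int t - 7"
        unfolding sq by (simp add: power2_eq_square algebra_simps)
      \<comment> \<open>With \<open>(int t + 3)\<^sup>2 \<le> 2 * H - 7\<close> it remains to see \<open>0 < H\<^sup>2 - 9 * H + 28\<close>; complete the square.\<close>
      moreover have "0 < (2 * int H - 9)\<^sup>2 + 31" by (simp add: add_nonneg_pos)
      ultimately show ?thesis by (simp add: power2_eq_square algebra_simps)
    qed
    then have "4 * (int t + 3)\<^sup>2 * (2 * int H) < int H * (int H - 1) * (2 * int H)"
      by (rule mult_strict_right_mono) (simp add: H_def)
    then have "int (4 * ((s - 1) * s)\<^sup>2) < int H * (int H - 1) * (2 * int H)"
      unfolding sq by (simp add: t power_mult_distrib ac_simps)
    also have "\<dots> = int (H * (H - 1) * (2 * H))" by (simp add: H_def of_nat_diff)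
    finally show ?thesis by (simp only: of_nat_less_iff)
  qed
  then show ?thesis
    using card_singular_fade_states_square_qam_le[of s]
      card_singular_fade_states_psk_ge[OF H_def] by (simp add: Ms[symmetric] MH[symmetric])
qed

end
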